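(* Let $g(x)=\frac{P(x)}{Q(x)}$, where $P$ and $Q$ are polynomials (with complex coefficients) with $\deg(P)<\deg(Q)$ and $Q(x)\neq0$ for all $x\in\mathbb{R}$. Then for any $c>0$ the set of $\alpha>0$ such that $\left(\alpha,\frac{c}{\alpha}\right)$ belongs to the frame set $\mathcal{F}_g$ is open.
   Context: Frame set: for $g\in L^2(\mathbb{R})$ and $\alpha,\beta>0$ let $\mathcal{G}(g;\alpha,\beta)=\{g_{n,m}\}_{n,m\in\mathbb{Z}}$, where $g_{n,m}(x)=g(x-n\alpha)e^{2\pi i m\beta x}$. The system $\mathcal{G}(g;\alpha,\beta)$ is a frame if there exist constants $A,B>0$ such that for all $f\in L^2(\mathbb{R})$ $$A\|f\|^2\le\sum_{n,m\in\mathbb{Z}}|\langle f,g_{n,m}\rangle|^2\le B\|f\|^2,$$ where $\|\cdot\|$ and $\langle\cdot,\cdot\rangle$ are the $L^2(\mathbb{R})$ norm and inner product. The frame set $\mathcal{F}_g$ is the set of all pairs $(\alpha,\beta)$ with $\alpha,\beta>0$ such that $\mathcal{G}(g;\alpha,\beta)$ is a frame. *)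

theory Defs
  imports "HOL-Analysis.Analysis" "HOL-Computational_Algebra.Polynomial"
begin

text \<open>Elements of $L^2(\mathbb{R})$ are represented by functions rather than by classes modulo
  almost-everywhere equality. Taking Borel measurable representatives loses no class, and
  everything below depends on the functions only up to almost-everywhere equality.\<close>

definition L2_fun :: "(real \<Rightarrow> complex) set" where
  "L2_fun = {f. f \<in> borel_measurable lborel \<and> integrable lborel (\<lambda>x. (cmod (f x))\<^sup>2)}"

definition L2_inner :: "(real \<Rightarrow> complex) \<Rightarrow> (real \<Rightarrow> complex) \<Rightarrow> complex" where
  "L2_inner f g = (LINT x|lborel. f x * cnj (g x))"

definition L2_norm :: "(real \<Rightarrow> complex) \<Rightarrow> real" where
  "L2_norm f = sqrt (LINT x|lborel. (cmod (f x))\<^sup>2)"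

definition gabor_atom ::
  "(real \<Rightarrow> complex) \<Rightarrow> real \<Rightarrow> real \<Rightarrow> int \<Rightarrow> int \<Rightarrow> real \<Rightarrow> complex" where
  "gabor_atom g \<alpha> \<beta> n m =
     (\<lambda>x. g (x - of_int n * \<alpha>) * exp (2 * of_real pi * \<i> * of_int m * of_real \<beta> * of_real x))"

text \<open>Summability is required explicitly because \<open>infsum\<close> is 0 on non-summable families;
  it is part of the upper frame bound.\<close>

definition gabor_frame :: "(real \<Rightarrow> complex) \<Rightarrow> real \<Rightarrow> real \<Rightarrow> bool" where
  "gabor_frame g \<alpha> \<beta> \<longleftrightarrow>
     (\<exists>A>0. \<exists>B>0. \<forall>f\<in>L2_fun.
        (\<lambda>(n, m). (cmod (L2_inner f (gabor_atom g \<alpha> \<beta> n m)))\<^sup>2) summable_on UNIV \<and>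
        A * (L2_norm f)\<^sup>2 \<le> (\<Sum>\<^sub>\<infinity>(n, m)\<in>UNIV. (cmod (L2_inner f (gabor_atom g \<alpha> \<beta> n m)))\<^sup>2) \<and>
        (\<Sum>\<^sub>\<infinity>(n, m)\<in>UNIV. (cmod (L2_inner f (gabor_atom g \<alpha> \<beta> n m)))\<^sup>2) \<le> B * (L2_norm f)\<^sup>2)"

text \<open>Meaningful for \<open>g \<in> L2_fun\<close>, so that all the inner products exist.\<close>

definition frame_set :: "(real \<Rightarrow> complex) \<Rightarrow> (real \<times> real) set" where
  "frame_set g = {(\<alpha>, \<beta>). \<alpha> > 0 \<and> \<beta> > 0 \<and> gabor_frame g \<alpha> \<beta>}"

end

theory Submission
  imports Defs
begin

text \<open>
  A dilation by \<open>\<alpha>\<close> turns the system with window \<open>g\<close> and parameters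
  \<open>(\<alpha>, c / \<alpha>)\<close> into the system with window \<open>G \<alpha> x = \<alpha> * g (\<alpha> * x)\<close>
  and the fixed parameters \<open>(1, c)\<close> (lemma \<open>gabor_frame_dilate\<close>). It remains to see
  that being a frame over a fixed lattice is an open condition on the window, in a topology in which
  \<open>G \<alpha>\<close> depends continuously on \<open>\<alpha>\<close>.

  Nearness of windows is measured by the weight \<open>1 / (1 + x\<^sup>2)\<close>. A window \<open>h\<close> with
  \<open>|h x| \<le> \<epsilon> / (1 + x\<^sup>2)\<close> generates a Bessel system with bound \<open>D * \<epsilon>\<^sup>2\<close>,
  where \<open>D\<close> depends on the lattice only (lemma \<open>gabor_bessel_bound\<close>). Consequently a
  frame survives a perturbation of its window by such an \<open>h\<close> as soon as \<open>\<epsilon>\<close> is small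
  (lemma \<open>gabor_frame_stable\<close>).

  A rational window of degree \<open>-1\<close> decays only like \<open>1 / x\<close>, so it is not itself
  dominated by the weight. The differences of its normalised dilates are: with the normalisation above the leading
  term \<open>k / x\<close> of \<open>G \<alpha>\<close> at infinity does not depend on \<open>\<alpha>\<close>, and
  \<open>G \<alpha> - G \<beta>\<close> is of order \<open>|\<alpha> - \<beta>| / (1 + x\<^sup>2)\<close> (lemma
  \<open>rational_dilation_lipschitz\<close>). The normalisation is harmless, since a nonzero constant factor
  only scales the frame bounds.
\<close>

section \<open>Lattice sums of the Cauchy weight\<close>

text \<open>
  The difference of two rational functions of degree \<open>-1\<close> with the same leading term
  decays at least at the rate of this weight. Sums of the weight over lattices are uniformly bounded, whereas
  those of its square root, the order of decay of the rational functions themselves, diverge.\<close>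

definition cauchy_weight :: "real \<Rightarrow> real" where
  "cauchy_weight x = 1 / (1 + x\<^sup>2)"

lemma cauchy_weight_pos: "0 < cauchy_weight x"
  by (simp add: cauchy_weight_def add_pos_nonneg)

lemma cauchy_weight_le_1: "cauchy_weight x \<le> 1"
  by (simp add: cauchy_weight_def divide_le_eq_1 add_pos_nonneg)

lemma cauchy_weight_measurable [measurable]: "cauchy_weight \<in> borel_measurable borel"
  unfolding cauchy_weight_def [abs_def] by measurable

text \<open>
  The weight is the derivative of \<open>arctan\<close>, and it changes at most by the factor
  \<open>2 + 2 L\<^sup>2\<close> over a distance \<open>L\<close>. So a single value of the weight is
  controlled by an increment of \<open>arctan\<close>, which makes sums over lattices telescope.\<close>

lemma cauchy_weight_le_arctan_diff:
  assumes "L > 0"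
  shows "L * cauchy_weight t \<le> (2 + 2 * L\<^sup>2) * (arctan (t + L) - arctan t)"
proof -
  have "\<exists>z. t < z \<and> z < t + L \<and> arctan (t + L) - arctan t = (t + L - t) * inverse (1 + z\<^sup>2)"
    by (rule MVT2) (use assms in \<open>auto intro!: DERIV_arctan\<close>)
  then obtain z where z: "t < z" "z < t + L"
    and eq: "arctan (t + L) - arctan t = L * inverse (1 + z\<^sup>2)" by auto
  have "\<bar>z - t\<bar> \<le> \<bar>L\<bar>" using z by auto
  then have "(z - t)\<^sup>2 \<le> L\<^sup>2" by (simp only: abs_le_square_iff)
  moreover have "z\<^sup>2 \<le> 2 * t\<^sup>2 + 2 * (z - t)\<^sup>2"
    using zero_le_power2[of "2 * t - z"] by (simp add: power2_eq_square algebra_simps)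
  moreover have "0 \<le> L\<^sup>2 * t\<^sup>2" by simp
  ultimately have "1 + z\<^sup>2 \<le> 2 + 2 * L\<^sup>2 + 2 * t\<^sup>2 + 2 * (L\<^sup>2 * t\<^sup>2)"
    by linarith
  then have "1 + z\<^sup>2 \<le> (2 + 2 * L\<^sup>2) * (1 + t\<^sup>2)"
    by (simp add: algebra_simps)
  then have "1 / (1 + t\<^sup>2) \<le> (2 + 2 * L\<^sup>2) / (1 + z\<^sup>2)"
    by (simp add: divide_simps add_pos_nonneg mult.commute)
  then show ?thesis
    using assms unfolding eq cauchy_weight_def
    by (simp add: divide_inverse mult.left_commute)
qed

lemma sum_int_telescope:
  fixes F :: "int \<Rightarrow> real"
  shows "(\<Sum>j = - int n..<int n. F (j + 1) - F j) = F (int n) - F (- int n)"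
proof (induction n)
  case (Suc n)
  have "{- int (Suc n)..<int (Suc n)} = insert (- int n - 1) (insert (int n) {- int n..<int n})"
    by auto
  then have "(\<Sum>j = - int (Suc n)..<int (Suc n). F (j + 1) - F j)
      = F (- int n) - F (- int n - 1) + (F (int n + 1) - F (int n)
        + (\<Sum>j = - int n..<int n. F (j + 1) - F j))"
    by (simp del: of_nat_Suc)
  moreover have "- int (Suc n) = - int n - 1" "int (Suc n) = int n + 1" by auto
  ultimately show ?case by (simp only: Suc.IH)
qed simp

text \<open>
  The increments of \<open>arctan\<close> over consecutive lattice cells telescope, and \<open>arctan\<close>
  has total variation \<open>\<pi>\<close>; neither depends on \<open>x\<close>.\<close>

lemma cauchy_weight_translates_bounded:
  assumes "L > 0"
  obtains K where "K > 0"
    "\<And>x J. finite J \<Longrightarrow> (\<Sum>j\<in>J. cauchy_weight (x + of_int j * L)) \<le> K"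
proof
  define C where "C = (2 + 2 * L\<^sup>2) / L"
  have C: "C > 0" using assms by (simp add: C_def add_pos_nonneg)
  show "C * pi > 0" using C by simp
  fix x :: real and J :: "int set"
  assume J: "finite J"
  define F where "F j = arctan (x + of_int j * L)" for j :: int
  have step: "cauchy_weight (x + of_int j * L) \<le> C * (F (j + 1) - F j)" for j
    using cauchy_weight_le_arctan_diff[OF assms, of "x + of_int j * L"] assms
    unfolding C_def F_def by (simp add: field_simps)
  obtain n :: nat where n: "J \<subseteq> {- int n..<int n}"
  proof
    show "J \<subseteq> {- int (nat (\<Sum>j\<in>J. \<bar>j\<bar>) + 1)..<int (nat (\<Sum>j\<in>J. \<bar>j\<bar>) + 1)}"
    proof
      fix j assume "j \<in> J"
      then have "\<bar>j\<bar> \<le> (\<Sum>j\<in>J. \<bar>j\<bar>)" using J by (intro member_le_sum) auto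
      then show "j \<in> {- int (nat (\<Sum>j\<in>J. \<bar>j\<bar>) + 1)..<int (nat (\<Sum>j\<in>J. \<bar>j\<bar>) + 1)}" by auto
    qed
  qed
  have "(\<Sum>j\<in>J. cauchy_weight (x + of_int j * L))
      \<le> (\<Sum>j = - int n..<int n. cauchy_weight (x + of_int j * L))"
    by (rule sum_mono2) (use n cauchy_weight_pos in \<open>auto intro: less_imp_le\<close>)
  also have "\<dots> \<le> (\<Sum>j = - int n..<int n. C * (F (j + 1) - F j))"
    by (rule sum_mono) (rule step)
  also have "\<dots> = C * (F (int n) - F (- int n))"
    by (simp only: sum_distrib_left[symmetric] sum_int_telescope)
  also have "\<dots> \<le> C * pi"
    using C arctan_ubound[of "x + int n * L"] arctan_lbound[of "x - int n * L"]
    by (simp add: F_def)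
  finally show "(\<Sum>j\<in>J. cauchy_weight (x + of_int j * L)) \<le> C * pi" .
qed

text \<open>
  Cut the line into the translates of \<open>[0, L)\<close>. Periodicity brings every piece back to
  \<open>[0, L)\<close>, where the translates of the weight add up to at most \<open>K\<close>.\<close>

lemma nn_integral_cauchy_weight_periodic_le:
  fixes p :: "real \<Rightarrow> ennreal"
  assumes L: "L > 0"
    and K: "\<And>x J. finite J \<Longrightarrow> (\<Sum>j\<in>J. cauchy_weight (x + of_int j * L)) \<le> K"
    and p [measurable]: "p \<in> borel_measurable borel"
    and per: "\<And>x j. p (x + of_int j * L) = p x"
  shows "(\<integral>\<^sup>+x. ennreal (cauchy_weight (x - t)) * p x \<partial>lborel)
           \<le> ennreal K * (\<integral>\<^sup>+x. p x * indicator {0..<L} x \<partial>lborel)"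
proof -
  \<comment> \<open>The cells are enumerated by naturals to make countable additivity applicable.\<close>
  define B where "B n = {of_int (int_decode n) * L..<of_int (int_decode n + 1) * L}" for n
  have inB: "x \<in> B n \<longleftrightarrow> \<lfloor>x / L\<rfloor> = int_decode n" for x n
    using L by (auto simp: B_def floor_eq_iff field_simps)
  have disj: "disjoint_family B"
    unfolding disjoint_family_on_def by (auto simp: inB int_decode_eq)
  have UN: "(\<Union>n. B n) = UNIV"
    using surj_int_decode by (auto simp: inB) (metis surjD)
  have piece: "(\<integral>\<^sup>+x\<in>B n. ennreal (cauchy_weight (x - t)) * p x \<partial>lborel)
      = (\<integral>\<^sup>+x. ennreal (cauchy_weight ((x - t) + of_int (int_decode n) * L))
            * (p x * indicator {0..<L} x) \<partial>lborel)" for n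
  proof -
    let ?s = "of_int (int_decode n) * L"
    have [measurable]: "B n \<in> sets borel" by (simp add: B_def)
    have "ennreal (cauchy_weight (?s + 1 * x - t)) * p (?s + 1 * x) * indicator (B n) (?s + 1 * x)
        = ennreal (cauchy_weight ((x - t) + ?s)) * (p x * indicator {0..<L} x)" for x
    proof -
      have "indicator (B n) (?s + 1 * x) = (indicator {0..<L} x :: ennreal)"
        by (auto simp: B_def indicator_def algebra_simps)
      moreover have "p (?s + 1 * x) = p x"
        using per[of x "int_decode n"] by (simp add: add.commute)
      moreover have "?s + 1 * x - t = (x - t) + ?s" by simp
      ultimately show ?thesis by (simp only: mult.assoc)
    qed
    then show ?thesis
      by (subst nn_integral_real_affine[where c = 1 and t = ?s]) simp_all
  qed
  have "(\<integral>\<^sup>+x. ennreal (cauchy_weight (x - t)) * p x \<partial>lborel)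
      = (\<integral>\<^sup>+x\<in>(\<Union>n. B n). ennreal (cauchy_weight (x - t)) * p x \<partial>lborel)"
    by (simp add: UN)
  also have "\<dots> = (\<Sum>n. \<integral>\<^sup>+x\<in>B n. ennreal (cauchy_weight (x - t)) * p x \<partial>lborel)"
    by (rule nn_integral_disjoint_family[OF _ _ disj]) (auto simp: B_def)
  also have "\<dots> = (\<integral>\<^sup>+x. (\<Sum>n. ennreal (cauchy_weight ((x - t) + of_int (int_decode n) * L))
            * (p x * indicator {0..<L} x)) \<partial>lborel)"
    unfolding piece by (rule nn_integral_suminf[symmetric]) measurable
  also have "\<dots> \<le> (\<integral>\<^sup>+x. ennreal K * (p x * indicator {0..<L} x) \<partial>lborel)"
  proof (rule nn_integral_mono)
    fix x
    have "(\<Sum>n. ennreal (cauchy_weight ((x - t) + of_int (int_decode n) * L))) \<le> ennreal K"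
    proof (rule suminf_le_const)
      fix n
      have "(\<Sum>k<n. ennreal (cauchy_weight ((x - t) + of_int (int_decode k) * L)))
          = ennreal (\<Sum>k<n. cauchy_weight ((x - t) + of_int (int_decode k) * L))"
        by (rule sum_ennreal) (simp add: cauchy_weight_pos less_imp_le)
      also have "(\<Sum>k<n. cauchy_weight ((x - t) + of_int (int_decode k) * L))
          = (\<Sum>j\<in>int_decode ` {..<n}. cauchy_weight ((x - t) + of_int j * L))"
        by (subst sum.reindex) (auto simp: inj_int_decode)
      also have "\<dots> \<le> K" by (rule K) simp
      finally show "(\<Sum>k<n. ennreal (cauchy_weight ((x - t) + of_int (int_decode k) * L)))
          \<le> ennreal K" by (simp add: ennreal_leI)
    qed simp
    then show "(\<Sum>n. ennreal (cauchy_weight ((x - t) + of_int (int_decode n) * L))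
            * (p x * indicator {0..<L} x)) \<le> ennreal K * (p x * indicator {0..<L} x)"
      by (simp only: ennreal_suminf_multc) (rule mult_right_mono, auto)
  qed
  also have "\<dots> = ennreal K * (\<integral>\<^sup>+x. p x * indicator {0..<L} x \<partial>lborel)"
    by (rule nn_integral_cmult) measurable
  finally show ?thesis .
qed

lemma integrable_cauchy_weight: "integrable lborel cauchy_weight"
proof -
  obtain K where "K > 0"
    and K: "\<And>x J. finite J \<Longrightarrow> (\<Sum>j\<in>J. cauchy_weight (x + of_int j * 1)) \<le> K"
    using cauchy_weight_translates_bounded[of 1] by auto
  have "(\<integral>\<^sup>+x. ennreal (cauchy_weight x) \<partial>lborel) \<le> ennreal K"
    using nn_integral_cauchy_weight_periodic_le[OF _ K, of "\<lambda>_. 1" 0] by simp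
  then have "(\<integral>\<^sup>+x. ennreal (norm (cauchy_weight x)) \<partial>lborel) < \<infinity>"
    using cauchy_weight_pos by (simp add: less_imp_le order_le_less_trans)
  then show ?thesis by (intro integrableI_bounded) auto
qed

section \<open>Trigonometric polynomials over one period\<close>

definition character :: "real \<Rightarrow> int \<Rightarrow> real \<Rightarrow> complex" where
  "character \<beta> m x = exp (2 * of_real pi * \<i> * of_int m * of_real \<beta> * of_real x)"

lemma character_measurable [measurable]: "character b m \<in> borel_measurable borel"
  unfolding character_def[abs_def]
  by (intro borel_measurable_continuous_onI continuous_intros)

lemma character_continuous: "continuous_on A (character b m)"
  unfolding character_def[abs_def] by (intro continuous_intros)

lemma norm_character [simp]: "cmod (character b m x) = 1"
  unfolding character_def by simp

lemma character_periodic: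
  assumes "b > 0"
  shows "character b m (x + of_int j * (1 / b)) = character b m x"
proof -
  have "2 * of_real pi * \<i> * of_int m * of_real b * of_real (x + of_int j * (1 / b))
     = 2 * of_real pi * \<i> * of_int m * of_real b * of_real x + 2 * of_int (m * j) * of_real pi * \<i>"
    using assms by (simp add: field_simps)
  moreover have "exp (2 * of_int (m * j) * of_real pi * \<i>) = (1 :: complex)"
    using exp_integer_2pi[of "real_of_int (m * j)"] by simp
  ultimately show ?thesis
    unfolding character_def by (simp only: exp_add mult_1_right)
qed

lemma character_mult_cnj: "character b m x * cnj (character b k x) = character b (m - k) x"
  unfolding character_def by (simp add: exp_cnj exp_add[symmetric] algebra_simps)

lemma integral_character:
  assumes "b > 0"
  shows "(LINT x|lborel. indicator {0..1 / b} x *\<^sub>R character b m x)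
           = (if m = 0 then of_real (1 / b) else 0)"
proof (cases "m = 0")
  case True
  then show ?thesis using assms by (simp add: character_def scaleR_conv_of_real)
next
  case False
  define w where "w = 2 * of_real pi * \<i> * of_int m * of_real b"
  have w: "w \<noteq> 0" using False assms by (simp add: w_def)
  have "(LINT x|lborel. indicator {0..1 / b} x *\<^sub>R character b m x)
      = exp (w * of_real (1 / b)) / w - exp (w * of_real 0) / w"
  proof (rule integral_FTC_Icc)
    fix x
    show "((\<lambda>x. exp (w * of_real x) / w) has_vector_derivative character b m x)
        (at x within {0..1 / b})"
      unfolding character_def w_def[symmetric]
      by (rule has_vector_derivative_real_field) (use w in \<open>auto intro!: derivative_eq_intros\<close>)
  qed (use assms character_continuous in auto)
  also have "\<dots> = 0"
    using character_periodic[OF assms, of m 0 1] by (simp add: character_def w_def)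
  finally show ?thesis using False by simp
qed

text \<open>
  Parseval for finite sums: on a period of length \<open>1 / b\<close> the characters are orthogonal with
  squared norm \<open>1 / b\<close>.\<close>

lemma nn_integral_trig_polynomial:
  assumes b: "b > 0" and M: "finite M"
  shows "(\<integral>\<^sup>+x. ennreal ((cmod (\<Sum>m\<in>M. c m * character b m x))\<^sup>2) * indicator {0..<1 / b} x \<partial>lborel)
           = ennreal ((\<Sum>m\<in>M. (cmod (c m))\<^sup>2) / b)"
proof -
  let ?S = "\<lambda>x. \<Sum>m\<in>M. c m * character b m x"
  have int: "integrable lborel (\<lambda>x. indicator {0..1 / b} x *\<^sub>R character b m x)" for m
    by (rule borel_integrable_compact) (auto simp: character_continuous)
  have expand: "complex_of_real (indicator {0..1 / b} x * (cmod (?S x))\<^sup>2)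
     = (\<Sum>m\<in>M. \<Sum>k\<in>M. c m * cnj (c k) * (indicator {0..1 / b} x *\<^sub>R character b (m - k) x))" for x
  proof -
    have "complex_of_real ((cmod (?S x))\<^sup>2) = ?S x * cnj (?S x)"
      by (simp only: complex_norm_square)
    also have "\<dots> = (\<Sum>m\<in>M. \<Sum>k\<in>M. c m * cnj (c k) * character b (m - k) x)"
      by (simp add: sum_product character_mult_cnj[symmetric] mult_ac)
    finally show ?thesis by (simp add: scaleR_conv_of_real sum_distrib_left mult_ac)
  qed
  have "complex_of_real (LINT x|lborel. indicator {0..1 / b} x * (cmod (?S x))\<^sup>2)
      = (LINT x|lborel. complex_of_real (indicator {0..1 / b} x * (cmod (?S x))\<^sup>2))"
    by (rule integral_complex_of_real[symmetric])
  also have "\<dots> = (\<Sum>m\<in>M. \<Sum>k\<in>M. c m * cnj (c k) *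
      (LINT x|lborel. indicator {0..1 / b} x *\<^sub>R character b (m - k) x))"
    unfolding expand
    by (simp only: Bochner_Integration.integral_sum Bochner_Integration.integrable_sum
        integrable_mult_right integral_mult_right_zero int)
  also have "\<dots> = (\<Sum>m\<in>M. \<Sum>k\<in>M. if k = m then c m * cnj (c k) / of_real b else 0)"
    unfolding integral_character[OF b] by (intro sum.cong) auto
  also have "\<dots> = complex_of_real ((\<Sum>m\<in>M. (cmod (c m))\<^sup>2) / b)"
    using M by (simp add: sum_divide_distrib complex_norm_square del: of_real_power)
  finally have val: "(LINT x|lborel. indicator {0..1 / b} x * (cmod (?S x))\<^sup>2)
      = (\<Sum>m\<in>M. (cmod (c m))\<^sup>2) / b" by (simp only: of_real_eq_iff)
  have intS: "integrable lborel (\<lambda>x. indicator {0..1 / b} x *\<^sub>R (cmod (?S x))\<^sup>2)"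
    by (rule borel_integrable_compact) (auto intro!: continuous_intros character_continuous)
  have "(\<integral>\<^sup>+x. ennreal ((cmod (?S x))\<^sup>2) * indicator {0..<1 / b} x \<partial>lborel)
      = (\<integral>\<^sup>+x. ennreal (indicator {0..1 / b} x *\<^sub>R (cmod (?S x))\<^sup>2) \<partial>lborel)"
    by (rule nn_integral_cong_AE, use AE_lborel_singleton[of "1 / b"] in eventually_elim)
      (auto simp: indicator_def)
  also have "\<dots> = ennreal (LINT x|lborel. indicator {0..1 / b} x *\<^sub>R (cmod (?S x))\<^sup>2)"
    by (rule nn_integral_eq_integral[OF intS]) auto
  finally show ?thesis by (simp add: val)
qed

section \<open>Square-integrable functions\<close>

lemma L2_fun_measurable: "f \<in> L2_fun \<Longrightarrow> f \<in> borel_measurable borel"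
  by (simp add: L2_fun_def)

lemma L2_fun_integrable: "f \<in> L2_fun \<Longrightarrow> integrable lborel (\<lambda>x. (cmod (f x))\<^sup>2)"
  by (simp add: L2_fun_def)

lemma L2_norm_sq: "(L2_norm f)\<^sup>2 = (LINT x|lborel. (cmod (f x))\<^sup>2)"
  by (simp add: L2_norm_def)

lemma mult_norm_le: "cmod a * cmod b \<le> ((cmod a)\<^sup>2 + (cmod b)\<^sup>2) / 2"
  using zero_le_power2[of "cmod a - cmod b"] by (simp add: power2_diff)

lemma norm_add_sq_le: "(cmod (a + b))\<^sup>2 \<le> 2 * (cmod a)\<^sup>2 + 2 * (cmod b)\<^sup>2"
proof -
  have "(cmod (a + b))\<^sup>2 \<le> (cmod a + cmod b)\<^sup>2"
    by (intro power_mono norm_triangle_ineq) simp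
  then show ?thesis using mult_norm_le[of a b] by (simp add: power2_sum)
qed

lemma cnj_measurable [measurable]: "cnj \<in> borel_measurable borel"
  by (intro borel_measurable_continuous_onI continuous_intros)

lemma L2_fun_product_integrable:
  assumes "f \<in> L2_fun" "g \<in> L2_fun"
  shows "integrable lborel (\<lambda>x. f x * cnj (g x))"
proof (rule Bochner_Integration.integrable_bound)
  show "integrable lborel (\<lambda>x. ((cmod (f x))\<^sup>2 + (cmod (g x))\<^sup>2) / 2)"
    using assms by (simp add: L2_fun_integrable)
  note [measurable] = assms[THEN L2_fun_measurable]
  show "(\<lambda>x. f x * cnj (g x)) \<in> borel_measurable lborel"
    by measurable
qed (use mult_norm_le in \<open>auto simp: norm_mult\<close>)

lemma L2_fun_add:
  assumes "f \<in> L2_fun" "g \<in> L2_fun"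
  shows "(\<lambda>x. f x + g x) \<in> L2_fun"
proof -
  note [measurable] = assms[THEN L2_fun_measurable]
  have "integrable lborel (\<lambda>x. (cmod (f x + g x))\<^sup>2)"
  proof (rule Bochner_Integration.integrable_bound)
    show "integrable lborel (\<lambda>x. 2 * (cmod (f x))\<^sup>2 + 2 * (cmod (g x))\<^sup>2)"
      using assms by (simp add: L2_fun_integrable)
  qed (use norm_add_sq_le in auto)
  then show ?thesis by (simp add: L2_fun_def)
qed

lemma L2_fun_cmult:
  assumes "f \<in> L2_fun"
  shows "(\<lambda>x. c * f x) \<in> L2_fun"
  using assms by (auto simp: L2_fun_def norm_mult power_mult_distrib)

lemma L2_fun_sum:
  assumes "\<And>i. i \<in> I \<Longrightarrow> f i \<in> L2_fun"
  shows "(\<lambda>x. \<Sum>i\<in>I. f i x) \<in> L2_fun"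
proof -
  have "(\<lambda>x. 0) \<in> L2_fun" by (simp add: L2_fun_def)
  then show ?thesis
    using assms by (induction I rule: infinite_finite_induct) (auto intro: L2_fun_add)
qed

lemma L2_fun_translate_modulate:
  assumes "h \<in> L2_fun"
  shows "(\<lambda>x. h (x - t) * character b m x) \<in> L2_fun"
proof -
  note [measurable] = assms[THEN L2_fun_measurable]
  have "integrable lborel (\<lambda>x. (cmod (h (x - t)))\<^sup>2)"
    using lborel_integrable_real_affine[OF L2_fun_integrable[OF assms], of 1 "- t"] by simp
  then show ?thesis by (simp add: L2_fun_def norm_mult)
qed

lemma gabor_atom_eq: "gabor_atom g a b n m = (\<lambda>x. g (x - of_int n * a) * character b m x)"
  by (simp add: gabor_atom_def character_def)

lemma gabor_atom_L2_fun: "g \<in> L2_fun \<Longrightarrow> gabor_atom g a b n m \<in> L2_fun"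
  unfolding gabor_atom_eq by (rule L2_fun_translate_modulate)

lemma L2_fun_if_sq_le_weight:
  assumes [measurable]: "h \<in> borel_measurable borel"
    and bound: "\<And>x. (cmod (h x))\<^sup>2 \<le> C * cauchy_weight x"
  shows "h \<in> L2_fun"
proof -
  have "integrable lborel (\<lambda>x. (cmod (h x))\<^sup>2)"
  proof (rule Bochner_Integration.integrable_bound)
    show "integrable lborel (\<lambda>x. C * cauchy_weight x)"
      using integrable_cauchy_weight by simp
  qed (use bound in \<open>auto intro: order_trans[OF _ abs_ge_self]\<close>)
  then show ?thesis by (simp add: L2_fun_def)
qed

lemma L2_fun_if_le_weight:
  assumes h: "h \<in> borel_measurable borel"
    and bound: "\<And>x. cmod (h x) \<le> \<epsilon> * cauchy_weight x"
  shows "h \<in> L2_fun"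
proof (rule L2_fun_if_sq_le_weight[OF h, where C = "\<epsilon>\<^sup>2"])
  fix x
  have "(cmod (h x))\<^sup>2 \<le> (\<epsilon> * cauchy_weight x)\<^sup>2" using bound by (intro power_mono) auto
  also have "\<dots> = \<epsilon>\<^sup>2 * cauchy_weight x * cauchy_weight x"
    by (simp add: power2_eq_square)
  also have "\<dots> \<le> \<epsilon>\<^sup>2 * cauchy_weight x"
    using cauchy_weight_pos[of x] cauchy_weight_le_1[of x]
    by (intro mult_left_le) auto
  finally show "(cmod (h x))\<^sup>2 \<le> \<epsilon>\<^sup>2 * cauchy_weight x" .
qed

section \<open>The Bessel bound for windows dominated by the Cauchy weight\<close>

lemma weighted_Cauchy_Schwarz:
  fixes w :: "'a \<Rightarrow> real" and z :: "'a \<Rightarrow> complex"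
  assumes "\<And>i. i \<in> I \<Longrightarrow> 0 \<le> w i"
  shows "(\<Sum>i\<in>I. w i * cmod (z i))\<^sup>2 \<le> (\<Sum>i\<in>I. w i) * (\<Sum>i\<in>I. w i * (cmod (z i))\<^sup>2)"
proof -
  have "(\<Sum>i\<in>I. sqrt (w i) * (sqrt (w i) * cmod (z i)))\<^sup>2
      \<le> (\<Sum>i\<in>I. (sqrt (w i))\<^sup>2) * (\<Sum>i\<in>I. (sqrt (w i) * cmod (z i))\<^sup>2)"
    by (rule Cauchy_Schwarz_ineq_sum)
  then show ?thesis using assms by (simp add: power_mult_distrib mult.assoc[symmetric] cong: sum.cong)
qed

text \<open>
  Group the sum as \<open>T x = (\<Sum>n\<in>N. h (x - n a) * S n x)\<close>, where each \<open>S n\<close>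
  is a trigonometric polynomial of period \<open>1 / b\<close>. The Cauchy--Schwarz inequality with the
  weights \<open>cauchy_weight (x - n a)\<close> costs one lattice sum of step \<open>a\<close> and removes
  the cross terms in \<open>n\<close>. Integrating the weight against the periodic function
  \<open>|S n|\<^sup>2\<close> costs one lattice sum of step \<open>1 / b\<close> and leaves an integral over
  a single period, which is computed by orthogonality. The constant depends on the lattice only, and
  \<open>\<epsilon>\<close> enters quadratically; this makes small windows have small Bessel bounds.\<close>

lemma gabor_synthesis_bound:
  assumes a: "a > 0" and b: "b > 0"
  obtains D where "D > 0"
    "\<And>h \<epsilon> N M c. h \<in> borel_measurable borel \<Longrightarrow> (\<And>x. cmod (h x) \<le> \<epsilon> * cauchy_weight x) \<Longrightarrow>
       finite N \<Longrightarrow> finite M \<Longrightarrow>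
       (L2_norm (\<lambda>x. \<Sum>n\<in>N. \<Sum>m\<in>M. c n m * gabor_atom h a b n m x))\<^sup>2
         \<le> D * \<epsilon>\<^sup>2 * (\<Sum>n\<in>N. \<Sum>m\<in>M. (cmod (c n m))\<^sup>2)"
proof -
  obtain K where K: "K > 0"
    and Ka: "\<And>x J. finite J \<Longrightarrow> (\<Sum>j\<in>J. cauchy_weight (x + of_int j * a)) \<le> K"
    using cauchy_weight_translates_bounded[OF a] by auto
  obtain K' where K': "K' > 0"
    and Kb: "\<And>x J. finite J \<Longrightarrow> (\<Sum>j\<in>J. cauchy_weight (x + of_int j * (1 / b))) \<le> K'"
    using cauchy_weight_translates_bounded[of "1 / b"] b by auto
  \<comment> \<open>The two lattice sums and the squared norm \<open>1 / b\<close> of a character over one period.\<close>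
  define D where "D = K * K' / b"
  have D: "D > 0" using K K' b by (simp add: D_def)
  show thesis
  proof (rule that[OF D])
    fix h :: "real \<Rightarrow> complex" and \<epsilon> :: real and N M :: "int set" and c :: "int \<Rightarrow> int \<Rightarrow> complex"
    assume h[measurable]: "h \<in> borel_measurable borel"
      and bound: "\<And>x. cmod (h x) \<le> \<epsilon> * cauchy_weight x"
      and N: "finite N" and M: "finite M"
    define S where "S n x = (\<Sum>m\<in>M. c n m * character b m x)" for n x
    define T where "T x = (\<Sum>n\<in>N. \<Sum>m\<in>M. c n m * gabor_atom h a b n m x)" for x
    have [measurable]: "S n \<in> borel_measurable borel" for n
      unfolding S_def[abs_def] by measurable
    have \<epsilon>: "\<epsilon> \<ge> 0"
    proof -
      have "0 \<le> \<epsilon> * cauchy_weight 0" using bound[of 0] norm_ge_zero order_trans by blast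
      then show ?thesis by (simp add: cauchy_weight_def)
    qed
    have w0: "0 \<le> cauchy_weight x" for x using cauchy_weight_pos[of x] by simp
    have T_eq: "T x = (\<Sum>n\<in>N. h (x - of_int n * a) * S n x)" for x
      unfolding T_def S_def gabor_atom_eq by (simp add: sum_distrib_left mult_ac)
    have T_L2: "T \<in> L2_fun"
      unfolding T_def
      by (intro L2_fun_sum L2_fun_cmult gabor_atom_L2_fun L2_fun_if_le_weight[OF h bound])
    have pointwise: "(cmod (T x))\<^sup>2
        \<le> \<epsilon>\<^sup>2 * K * (\<Sum>n\<in>N. cauchy_weight (x - of_int n * a) * (cmod (S n x))\<^sup>2)" for x
    proof -
      have wK: "(\<Sum>n\<in>N. cauchy_weight (x - of_int n * a)) \<le> K"
        using Ka[of "uminus ` N" x] N by (simp add: sum.reindex)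
      have "cmod (T x) \<le> (\<Sum>n\<in>N. \<epsilon> * cauchy_weight (x - of_int n * a) * cmod (S n x))"
        unfolding T_eq by (rule sum_norm_le) (auto simp: norm_mult intro!: mult_right_mono bound)
      also have "\<dots> = \<epsilon> * (\<Sum>n\<in>N. cauchy_weight (x - of_int n * a) * cmod (S n x))"
        by (simp add: sum_distrib_left mult.assoc)
      finally have "(cmod (T x))\<^sup>2 \<le> (\<epsilon> * (\<Sum>n\<in>N. cauchy_weight (x - of_int n * a) * cmod (S n x)))\<^sup>2"
        by (rule power_mono) simp
      also have "\<dots> \<le> \<epsilon>\<^sup>2 * ((\<Sum>n\<in>N. cauchy_weight (x - of_int n * a)) *
          (\<Sum>n\<in>N. cauchy_weight (x - of_int n * a) * (cmod (S n x))\<^sup>2))"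
        unfolding power_mult_distrib
        by (intro mult_left_mono weighted_Cauchy_Schwarz w0) simp
      also have "\<dots> \<le> \<epsilon>\<^sup>2 * (K *
          (\<Sum>n\<in>N. cauchy_weight (x - of_int n * a) * (cmod (S n x))\<^sup>2))"
        by (intro mult_left_mono mult_right_mono wK sum_nonneg) (auto simp: w0)
      finally show ?thesis by (simp add: mult.assoc)
    qed
    have piece: "(\<integral>\<^sup>+x. ennreal (cauchy_weight (x - of_int n * a)) * ennreal ((cmod (S n x))\<^sup>2) \<partial>lborel)
        \<le> ennreal (K' * ((\<Sum>m\<in>M. (cmod (c n m))\<^sup>2) / b))" for n
    proof -
      have "(\<integral>\<^sup>+x. ennreal (cauchy_weight (x - of_int n * a)) * ennreal ((cmod (S n x))\<^sup>2) \<partial>lborel)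
        \<le> ennreal K' * (\<integral>\<^sup>+x. ennreal ((cmod (S n x))\<^sup>2) * indicator {0..<1 / b} x \<partial>lborel)"
      proof (rule nn_integral_cauchy_weight_periodic_le[OF _ Kb])
        show "ennreal ((cmod (S n (x + of_int j * (1 / b))))\<^sup>2) = ennreal ((cmod (S n x))\<^sup>2)" for x j
          unfolding S_def character_periodic[OF b] ..
      qed (use b in auto)
      also have "\<dots> = ennreal (K' * ((\<Sum>m\<in>M. (cmod (c n m))\<^sup>2) / b))"
        unfolding S_def nn_integral_trig_polynomial[OF b M]
        using K' b by (intro ennreal_mult[symmetric]) (auto intro!: divide_nonneg_pos sum_nonneg)
      finally show ?thesis .
    qed
    have "ennreal ((L2_norm T)\<^sup>2) = (\<integral>\<^sup>+x. ennreal ((cmod (T x))\<^sup>2) \<partial>lborel)"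
      unfolding L2_norm_sq
      by (rule nn_integral_eq_integral[symmetric]) (auto simp: L2_fun_integrable T_L2)
    also have "\<dots> \<le> (\<integral>\<^sup>+x. ennreal (\<epsilon>\<^sup>2 * K) *
        (\<Sum>n\<in>N. ennreal (cauchy_weight (x - of_int n * a)) * ennreal ((cmod (S n x))\<^sup>2)) \<partial>lborel)"
    proof (rule nn_integral_mono)
      fix x
      show "ennreal ((cmod (T x))\<^sup>2) \<le> ennreal (\<epsilon>\<^sup>2 * K) *
        (\<Sum>n\<in>N. ennreal (cauchy_weight (x - of_int n * a)) * ennreal ((cmod (S n x))\<^sup>2))"
        using pointwise[of x] K w0
        by (simp add: ennreal_mult[symmetric] sum_ennreal sum_nonneg ennreal_leI)
    qed
    also have "\<dots> = ennreal (\<epsilon>\<^sup>2 * K) * (\<Sum>n\<in>N.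
        \<integral>\<^sup>+x. ennreal (cauchy_weight (x - of_int n * a)) * ennreal ((cmod (S n x))\<^sup>2) \<partial>lborel)"
      by (simp add: nn_integral_cmult nn_integral_sum)
    also have "\<dots> \<le> ennreal (\<epsilon>\<^sup>2 * K) * (\<Sum>n\<in>N. ennreal (K' * ((\<Sum>m\<in>M. (cmod (c n m))\<^sup>2) / b)))"
      by (intro mult_left_mono sum_mono piece) simp
    also have "\<dots> = ennreal (D * \<epsilon>\<^sup>2 * (\<Sum>n\<in>N. \<Sum>m\<in>M. (cmod (c n m))\<^sup>2))"
      using K K' b
      by (simp add: sum_ennreal sum_nonneg ennreal_mult[symmetric] D_def sum_distrib_left
          sum_divide_distrib mult_ac)
    finally show "(L2_norm (\<lambda>x. \<Sum>n\<in>N. \<Sum>m\<in>M. c n m * gabor_atom h a b n m x))\<^sup>2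
         \<le> D * \<epsilon>\<^sup>2 * (\<Sum>n\<in>N. \<Sum>m\<in>M. (cmod (c n m))\<^sup>2)"
      using D by (subst (asm) ennreal_le_iff) (auto simp: T_def[abs_def] intro!: sum_nonneg mult_nonneg_nonneg)
  qed
qed

text \<open>
  The analysis map is adjoint to the synthesis map, so it has the same norm. Concretely, if the
  coefficients \<open>c n m\<close> are themselves the inner products of \<open>f\<close> with the atoms,
  then \<open>X = \<Sum>|c n m|\<^sup>2\<close> is the inner product of \<open>f\<close> with the synthesised
  function \<open>T\<close>, whose squared norm is at most \<open>D \<epsilon>\<^sup>2 X\<close>. Absorbing this term
  bounds \<open>X\<close>.\<close>

lemma gabor_bessel_bound:
  assumes a: "a > 0" and b: "b > 0"
  obtains D where "D > 0"
    "\<And>h \<epsilon> f F. h \<in> borel_measurable borel \<Longrightarrow> (\<And>x. cmod (h x) \<le> \<epsilon> * cauchy_weight x) \<Longrightarrow>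
       f \<in> L2_fun \<Longrightarrow> finite F \<Longrightarrow>
       (\<Sum>(n, m)\<in>F. (cmod (L2_inner f (gabor_atom h a b n m)))\<^sup>2) \<le> D * \<epsilon>\<^sup>2 * (L2_norm f)\<^sup>2"
proof (rule gabor_synthesis_bound[OF a b])
  fix D :: real
  assume D: "D > 0" and synthesis:
    "\<And>h \<epsilon> N M c. h \<in> borel_measurable borel \<Longrightarrow> (\<And>x. cmod (h x) \<le> \<epsilon> * cauchy_weight x) \<Longrightarrow>
       finite N \<Longrightarrow> finite M \<Longrightarrow>
       (L2_norm (\<lambda>x. \<Sum>n\<in>N. \<Sum>m\<in>M. c n m * gabor_atom h a b n m x))\<^sup>2
         \<le> D * \<epsilon>\<^sup>2 * (\<Sum>n\<in>N. \<Sum>m\<in>M. (cmod (c n m))\<^sup>2)"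
  show thesis
  proof (rule that[OF D])
    fix h :: "real \<Rightarrow> complex" and \<epsilon> :: real and f :: "real \<Rightarrow> complex" and F :: "(int \<times> int) set"
    assume h: "h \<in> borel_measurable borel"
      and bound: "\<And>x. cmod (h x) \<le> \<epsilon> * cauchy_weight x"
      and f: "f \<in> L2_fun" and F: "finite F"
    define N M where "N = fst ` F" and "M = snd ` F"
    have NM: "finite N" "finite M" "F \<subseteq> N \<times> M" using F by (auto simp: N_def M_def rev_image_eqI)
    define c where "c n m = L2_inner f (gabor_atom h a b n m)" for n m
    define X where "X = (\<Sum>n\<in>N. \<Sum>m\<in>M. (cmod (c n m))\<^sup>2)"
    define T where "T x = (\<Sum>n\<in>N. \<Sum>m\<in>M. c n m * gabor_atom h a b n m x)" for x
    have atom: "gabor_atom h a b n m \<in> L2_fun" for n m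
      by (intro gabor_atom_L2_fun L2_fun_if_le_weight[OF h bound])
    have T: "T \<in> L2_fun"
      unfolding T_def by (intro L2_fun_sum L2_fun_cmult atom)
    have T_bound: "(L2_norm T)\<^sup>2 \<le> D * \<epsilon>\<^sup>2 * X"
      unfolding T_def[abs_def] X_def by (rule synthesis[OF h bound NM(1,2)])
    have X_inner: "complex_of_real X = L2_inner f T"
    proof -
      have "L2_inner f T = (LINT x|lborel. (\<Sum>n\<in>N. \<Sum>m\<in>M. cnj (c n m) * (f x * cnj (gabor_atom h a b n m x))))"
        unfolding L2_inner_def T_def by (simp add: sum_distrib_left mult_ac)
      also have "\<dots> = (\<Sum>n\<in>N. \<Sum>m\<in>M. cnj (c n m) * c n m)"
        unfolding c_def L2_inner_def
        by (simp only: Bochner_Integration.integral_sum Bochner_Integration.integrable_sum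
            integrable_mult_right integral_mult_right_zero L2_fun_product_integrable[OF f atom])
      also have "\<dots> = complex_of_real X"
        unfolding X_def by (simp add: complex_norm_square mult.commute del: of_real_power)
      finally show ?thesis ..
    qed
    \<comment> \<open>The parameter \<open>s\<close> is chosen below as \<open>D \<epsilon>\<^sup>2\<close>, for which half of the
      left-hand side absorbs the norm of \<open>T\<close>.\<close>
    have young: "s * X \<le> (s\<^sup>2 * (L2_norm f)\<^sup>2 + (L2_norm T)\<^sup>2) / 2" if "s \<ge> 0" for s
    proof -
      have "s * X = cmod (L2_inner (\<lambda>x. of_real s * f x) T)"
      proof -
        have "L2_inner (\<lambda>x. of_real s * f x) T = of_real s * of_real X"
          unfolding X_inner L2_inner_def by (simp add: mult.assoc)
        moreover have "X \<ge> 0" by (auto simp: X_def intro!: sum_nonneg)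
        ultimately show ?thesis using that by (simp add: norm_mult)
      qed
      also have "\<dots> \<le> (LINT x|lborel. cmod ((of_real s * f x) * cnj (T x)))"
        unfolding L2_inner_def by (rule integral_norm_bound)
      also have "\<dots> \<le> (LINT x|lborel. (s\<^sup>2 * (cmod (f x))\<^sup>2 + (cmod (T x))\<^sup>2) / 2)"
      proof (rule integral_mono)
        show "integrable lborel (\<lambda>x. cmod ((of_real s * f x) * cnj (T x)))"
          by (intro integrable_norm L2_fun_product_integrable L2_fun_cmult f T)
        show "integrable lborel (\<lambda>x. (s\<^sup>2 * (cmod (f x))\<^sup>2 + (cmod (T x))\<^sup>2) / 2)"
          using L2_fun_integrable[OF f] L2_fun_integrable[OF T] by simp
        show "cmod ((of_real s * f x) * cnj (T x)) \<le> (s\<^sup>2 * (cmod (f x))\<^sup>2 + (cmod (T x))\<^sup>2) / 2" for x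
          using mult_norm_le[of "of_real s * f x" "T x"] by (simp add: norm_mult power_mult_distrib)
      qed
      also have "\<dots> = (s\<^sup>2 * (L2_norm f)\<^sup>2 + (L2_norm T)\<^sup>2) / 2"
        using L2_fun_integrable[OF f] L2_fun_integrable[OF T] by (simp add: L2_norm_sq)
      finally show ?thesis .
    qed
    have X_le: "X \<le> D * \<epsilon>\<^sup>2 * (L2_norm f)\<^sup>2"
    proof (cases "\<epsilon> = 0")
      case True
      then have "cmod (h x) \<le> 0" for x using bound[of x] True by simp
      then have "c n m = 0" for n m
        by (simp add: c_def L2_inner_def gabor_atom_def)
      then show ?thesis by (simp add: X_def True)
    next
      case False
      define E where "E = D * \<epsilon>\<^sup>2"
      have E: "E > 0" using False D by (simp add: E_def)
      have "2 * (E * X) \<le> E\<^sup>2 * (L2_norm f)\<^sup>2 + (L2_norm T)\<^sup>2"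
        using young[OF less_imp_le[OF E]] by (simp only: pos_le_divide_eq zero_less_numeral mult.commute[of _ 2])
      moreover have "(L2_norm T)\<^sup>2 \<le> E * X" using T_bound by (simp only: E_def)
      ultimately have "E * X \<le> E\<^sup>2 * (L2_norm f)\<^sup>2" by linarith
      then have "E * X \<le> E * (E * (L2_norm f)\<^sup>2)"
        by (simp only: power2_eq_square mult.assoc)
      then show ?thesis using E unfolding E_def[symmetric] by (simp only: mult_le_cancel_left_pos)
    qed
    have "(\<Sum>(n, m)\<in>F. (cmod (c n m))\<^sup>2) \<le> (\<Sum>(n, m)\<in>N \<times> M. (cmod (c n m))\<^sup>2)"
      using NM by (intro sum_mono2) auto
    also have "\<dots> = X" by (simp add: X_def sum.cartesian_product)
    finally show "(\<Sum>(n, m)\<in>F. (cmod (L2_inner f (gabor_atom h a b n m)))\<^sup>2) \<le> D * \<epsilon>\<^sup>2 * (L2_norm f)\<^sup>2"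
      using X_le by (simp add: c_def)
  qed
qed

section \<open>Stability and dilation of Gabor frames\<close>

lemma L2_inner_add_right:
  assumes "f \<in> L2_fun" "g \<in> L2_fun" "h \<in> L2_fun"
  shows "L2_inner f (\<lambda>x. g x + h x) = L2_inner f g + L2_inner f h"
  unfolding L2_inner_def
  by (simp add: distrib_left L2_fun_product_integrable assms)

text \<open>
  The coefficients with respect to \<open>g'\<close> differ from those with respect to \<open>g\<close> by
  the coefficients with respect to \<open>g' - g\<close>. By the Bessel bound the latter have square sum
  at most \<open>A / 4\<close> times \<open>(L2_norm f)\<^sup>2\<close> once \<open>\<epsilon>\<close> is small, where
  \<open>A\<close> is the lower frame bound of \<open>g\<close>. Then
  \<open>|u + v|\<^sup>2 \<le> 2 |u|\<^sup>2 + 2 |v|\<^sup>2\<close>, used in both directions, transfers both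
  frame bounds.\<close>

lemma gabor_frame_stable:
  assumes a: "a > 0" and b: "b > 0" and g: "g \<in> L2_fun" and frame: "gabor_frame g a b"
  obtains \<epsilon> where "\<epsilon> > 0"
    "\<And>g'. g' \<in> borel_measurable borel \<Longrightarrow> (\<And>x. cmod (g' x - g x) \<le> \<epsilon> * cauchy_weight x)
        \<Longrightarrow> gabor_frame g' a b"
proof (rule gabor_bessel_bound[OF a b])
  fix D :: real
  assume D: "D > 0" and bessel:
    "\<And>h \<epsilon> f F. h \<in> borel_measurable borel \<Longrightarrow> (\<And>x. cmod (h x) \<le> \<epsilon> * cauchy_weight x) \<Longrightarrow>
       f \<in> L2_fun \<Longrightarrow> finite F \<Longrightarrow>
       (\<Sum>(n, m)\<in>F. (cmod (L2_inner f (gabor_atom h a b n m)))\<^sup>2) \<le> D * \<epsilon>\<^sup>2 * (L2_norm f)\<^sup>2"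
  define c where "c g f p = (cmod (L2_inner f (gabor_atom g a b (fst p) (snd p))))\<^sup>2"
    for g :: "real \<Rightarrow> complex" and f p
  have frame_iff: "gabor_frame g a b \<longleftrightarrow> (\<exists>A>0. \<exists>B>0. \<forall>f\<in>L2_fun. c g f summable_on UNIV \<and>
      A * (L2_norm f)\<^sup>2 \<le> infsum (c g f) UNIV \<and> infsum (c g f) UNIV \<le> B * (L2_norm f)\<^sup>2)" for g
    unfolding gabor_frame_def c_def[abs_def] by (simp add: case_prod_unfold)
  obtain A B where A: "A > 0" and B: "B > 0"
    and summable: "\<And>f. f \<in> L2_fun \<Longrightarrow> c g f summable_on UNIV"
    and lower: "\<And>f. f \<in> L2_fun \<Longrightarrow> A * (L2_norm f)\<^sup>2 \<le> infsum (c g f) UNIV"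
    and upper: "\<And>f. f \<in> L2_fun \<Longrightarrow> infsum (c g f) UNIV \<le> B * (L2_norm f)\<^sup>2"
    using frame unfolding frame_iff by blast
  define \<epsilon> where "\<epsilon> = sqrt (A / (4 * D))"
  have \<epsilon>: "\<epsilon> > 0" "D * \<epsilon>\<^sup>2 = A / 4" using A D by (auto simp: \<epsilon>_def)
  show thesis
  proof (rule that[OF \<epsilon>(1)])
    fix g' :: "real \<Rightarrow> complex"
    assume g'[measurable]: "g' \<in> borel_measurable borel"
      and close: "\<And>x. cmod (g' x - g x) \<le> \<epsilon> * cauchy_weight x"
    define h where "h x = g' x - g x" for x
    note [measurable] = L2_fun_measurable[OF g]
    have h_meas: "h \<in> borel_measurable borel" unfolding h_def by measurable
    have h_bound: "cmod (h x) \<le> \<epsilon> * cauchy_weight x" for x using close by (simp add: h_def)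
    have h: "h \<in> L2_fun" by (rule L2_fun_if_le_weight[OF h_meas h_bound])
    have "gabor_frame g' a b"
      unfolding frame_iff
    proof (intro exI conjI ballI)
      show "A / 4 > 0" "2 * B + A / 2 > 0" using A B by auto
      fix f assume f: "f \<in> L2_fun"
      have inner: "L2_inner f (gabor_atom g' a b n m)
          = L2_inner f (gabor_atom g a b n m) + L2_inner f (gabor_atom h a b n m)" for n m
      proof -
        have "gabor_atom g' a b n m = (\<lambda>x. gabor_atom g a b n m x + gabor_atom h a b n m x)"
          by (simp add: gabor_atom_def h_def algebra_simps)
        then show ?thesis by (simp add: L2_inner_add_right f gabor_atom_L2_fun g h)
      qed
      have c_nonneg: "0 \<le> c g f p" for g p by (simp add: c_def)
      have fin: "sum (c h f) F \<le> A / 4 * (L2_norm f)\<^sup>2" if "finite F" for F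
        using bessel[OF h_meas h_bound f that] by (simp add: c_def case_prod_beta \<epsilon>(2))
      have sum_h: "c h f summable_on UNIV"
        by (rule nonneg_bdd_above_summable_on[OF c_nonneg bdd_aboveI2]) (use fin in blast)
      have inf_h: "infsum (c h f) UNIV \<le> A / 4 * (L2_norm f)\<^sup>2"
        by (rule infsum_le_finite_sums[OF sum_h]) (rule fin)
      have c_le: "c g' f p \<le> 2 * c g f p + 2 * c h f p" for p
        unfolding c_def inner by (rule norm_add_sq_le)
      have c_ge: "c g f p \<le> 2 * c g' f p + 2 * c h f p" for p
        using norm_add_sq_le[of "L2_inner f (gabor_atom g' a b (fst p) (snd p))"
            "- L2_inner f (gabor_atom h a b (fst p) (snd p))"]
        by (simp add: c_def inner)
      note cmult = summable_on_cmult_right[where c = "2::real"]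
      note sums = cmult[OF summable[OF f]] cmult[OF sum_h]
      show sum': "c g' f summable_on UNIV"
        by (rule summable_on_comparison_test[OF summable_on_add[OF sums]])
          (auto simp: c_le c_nonneg)
      have "infsum (c g' f) UNIV \<le> infsum (\<lambda>p. 2 * c g f p + 2 * c h f p) UNIV"
        by (rule infsum_mono[OF sum' summable_on_add[OF sums] c_le])
      also have "\<dots> = 2 * infsum (c g f) UNIV + 2 * infsum (c h f) UNIV"
        by (simp add: infsum_add[OF sums] infsum_cmult_right')
      finally show "infsum (c g' f) UNIV \<le> (2 * B + A / 2) * (L2_norm f)\<^sup>2"
        using upper[OF f] inf_h by (simp add: algebra_simps)
      have "infsum (c g f) UNIV \<le> infsum (\<lambda>p. 2 * c g' f p + 2 * c h f p) UNIV"
        by (rule infsum_mono[OF summable[OF f] summable_on_add[OF cmult[OF sum'] sums(2)] c_ge])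
      also have "\<dots> = 2 * infsum (c g' f) UNIV + 2 * infsum (c h f) UNIV"
        by (simp add: infsum_add[OF cmult[OF sum'] sums(2)] infsum_cmult_right')
      finally show "A / 4 * (L2_norm f)\<^sup>2 \<le> infsum (c g' f) UNIV"
        using lower[OF f] inf_h by (simp add: algebra_simps)
    qed
    then show "gabor_frame g' a b" .
  qed
qed

lemma L2_fun_dilate:
  assumes s: "s > 0" and f: "f \<in> L2_fun"
  shows "(\<lambda>x. f (s * x)) \<in> L2_fun"
proof -
  note [measurable] = L2_fun_measurable[OF f]
  show ?thesis
    using lborel_integrable_real_affine[OF L2_fun_integrable[OF f], of s 0] s
    by (simp add: L2_fun_def)
qed

lemma L2_norm_dilate:
  assumes s: "s > 0"
  shows "(L2_norm f)\<^sup>2 = s * (L2_norm (\<lambda>x. f (s * x)))\<^sup>2"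
  unfolding L2_norm_sq
  by (subst lborel_integral_real_affine[of s _ 0]) (use s in simp_all)

text \<open>
  Substitute \<open>x \<mapsto> s * x\<close> in every inner product. With the factor \<open>s\<close> (rather
  than the unitary \<open>sqrt s\<close>) in front of the dilated window the coefficients are literally the
  same, and both frame bounds are multiplied by \<open>s\<close>, because the test function \<open>f\<close>
  changes its norm.\<close>

lemma gabor_frame_dilate:
  assumes s: "s > 0" and frame: "gabor_frame g a b"
  shows "gabor_frame (\<lambda>x. of_real s * g (s * x)) (a / s) (s * b)"
proof -
  let ?g = "\<lambda>x. of_real s * g (s * x)"
  let ?c = "\<lambda>f. \<lambda>(n, m). (cmod (L2_inner f (gabor_atom g a b n m)))\<^sup>2"
  obtain A B where A: "A > 0" and B: "B > 0"
    and bounds: "\<And>f. f \<in> L2_fun \<Longrightarrow> ?c f summable_on UNIV \<and>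
        A * (L2_norm f)\<^sup>2 \<le> infsum (?c f) UNIV \<and> infsum (?c f) UNIV \<le> B * (L2_norm f)\<^sup>2"
    using frame unfolding gabor_frame_def by blast
  show ?thesis
    unfolding gabor_frame_def
  proof (intro exI conjI ballI)
    show "A * s > 0" "B * s > 0" using A B s by auto
    fix f assume f: "f \<in> L2_fun"
    define f' where "f' x = f (x / s)" for x
    have f': "f' \<in> L2_fun" using L2_fun_dilate[of "1 / s", OF _ f] s by (simp add: f'_def[abs_def])
    have norm: "(L2_norm f')\<^sup>2 = s * (L2_norm f)\<^sup>2"
      using L2_norm_dilate[OF s, of f'] s by (simp add: f'_def)
    have inner: "L2_inner f (gabor_atom ?g (a / s) (s * b) n m) = L2_inner f' (gabor_atom g a b n m)" for n m
    proof -
      have "L2_inner f' (gabor_atom g a b n m)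
          = s *\<^sub>R (LINT x|lborel. f' (0 + s * x) * cnj (gabor_atom g a b n m (0 + s * x)))"
        unfolding L2_inner_def
        using lborel_integral_real_affine[of s "\<lambda>x. f' x * cnj (gabor_atom g a b n m x)" 0] s by simp
      also have "\<dots> = (LINT x|lborel. s *\<^sub>R (f' (0 + s * x) * cnj (gabor_atom g a b n m (0 + s * x))))"
        by simp
      also have "\<dots> = L2_inner f (gabor_atom ?g (a / s) (s * b) n m)"
        unfolding L2_inner_def gabor_atom_def f'_def
        using s by (intro Bochner_Integration.integral_cong)
          (simp_all add: scaleR_conv_of_real right_diff_distrib mult_ac)
      finally show ?thesis ..
    qed
    show "(\<lambda>(n, m). (cmod (L2_inner f (gabor_atom ?g (a / s) (s * b) n m)))\<^sup>2) summable_on UNIV"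
      "A * s * (L2_norm f)\<^sup>2 \<le> (\<Sum>\<^sub>\<infinity>(n, m). (cmod (L2_inner f (gabor_atom ?g (a / s) (s * b) n m)))\<^sup>2)"
      "(\<Sum>\<^sub>\<infinity>(n, m). (cmod (L2_inner f (gabor_atom ?g (a / s) (s * b) n m)))\<^sup>2) \<le> B * s * (L2_norm f)\<^sup>2"
      using bounds[OF f'] unfolding inner norm by (auto simp: mult.assoc)
  qed
qed

lemma gabor_frame_dilate_iff:
  assumes s: "s > 0"
  shows "gabor_frame (\<lambda>x. of_real s * g (s * x)) (a / s) (s * b) \<longleftrightarrow> gabor_frame g a b"
proof
  assume "gabor_frame (\<lambda>x. of_real s * g (s * x)) (a / s) (s * b)"
  from gabor_frame_dilate[OF _ this, of "1 / s"] s show "gabor_frame g a b"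
    by (simp add: mult.assoc[symmetric])
qed (rule gabor_frame_dilate[OF s])

section \<open>Rational windows\<close>

lemma degree_reduce:
  fixes Q R :: "'a :: field poly"
  assumes Q: "Q \<noteq> 0" and deg: "degree R \<le> degree Q"
  obtains k S where "R = smult k Q + S" "S = 0 \<or> degree S < degree Q"
proof
  define k where "k = coeff R (degree Q) / lead_coeff Q"
  define S where "S = R - smult k Q"
  show "R = smult k Q + S" by (simp add: S_def)
  have "degree S \<le> degree Q"
    unfolding S_def by (rule degree_diff_le[OF deg degree_smult_le])
  moreover have "coeff S (degree Q) = 0" using Q by (simp add: S_def k_def)
  ultimately show "S = 0 \<or> degree S < degree Q" by (rule eq_zero_or_degree_less)
qed

text \<open>
  The Wronskian of \<open>R\<close> and \<open>Q\<close> does not change when a multiple of \<open>Q\<close> is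
  subtracted from \<open>R\<close>, so the degree of \<open>R\<close> may be taken below that of \<open>Q\<close>.
  The Wronskian then has degree at most \<open>2 * degree Q - 2\<close>, one less than the
  degrees of the two products suggest. In other words, the derivative of a rational function that is
  bounded at infinity decays like \<open>1 / x\<^sup>2\<close>.\<close>

lemma degree_wronskian:
  fixes Q R :: "'a :: field_char_0 poly"
  assumes Q: "Q \<noteq> 0" and deg: "degree R \<le> degree Q"
  shows "degree ((pderiv R * Q - R * pderiv Q) * [:1, 0, 1:]) \<le> degree (Q * Q)"
proof -
  obtain k S where R: "R = smult k Q + S" and S: "S = 0 \<or> degree S < degree Q"
    using degree_reduce[OF Q deg] .
  have W: "pderiv R * Q - R * pderiv Q = pderiv S * Q - S * pderiv Q"
    by (simp add: R pderiv_add pderiv_smult algebra_simps)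
  show ?thesis
  proof (cases "S = 0")
    case True
    then show ?thesis unfolding W by simp
  next
    case False
    then have lt: "degree S < degree Q" using S by simp
    have "degree (pderiv S * Q) \<le> 2 * degree Q - 2"
    proof (cases "degree S = 0")
      case True
      then have "pderiv S = 0" by (simp add: pderiv_eq_0_iff)
      then show ?thesis by simp
    next
      case False
      then show ?thesis
        using lt by (intro order_trans[OF degree_mult_le]) (simp add: degree_pderiv)
    qed
    moreover have "degree (S * pderiv Q) \<le> 2 * degree Q - 2"
      using lt by (intro order_trans[OF degree_mult_le]) (simp add: degree_pderiv)
    ultimately have "degree (pderiv S * Q - S * pderiv Q) \<le> 2 * degree Q - 2"
      by (rule degree_diff_le)
    then have "degree ((pderiv S * Q - S * pderiv Q) * [:1, 0, 1:]) \<le> 2 * degree Q - 2 + 2"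
      by (intro order_trans[OF degree_mult_le]) simp
    also have "\<dots> = degree (Q * Q)" using lt Q by (simp add: degree_mult_eq)
    finally show ?thesis unfolding W .
  qed
qed

lemma rational_bounded_on_reals:
  fixes N Q :: "complex poly"
  assumes Q: "\<And>x::real. poly Q (of_real x) \<noteq> 0" and deg: "degree N \<le> degree Q"
  obtains C where "\<And>x::real. cmod (poly N (of_real x) / poly Q (of_real x)) \<le> C"
proof -
  have Q0: "Q \<noteq> 0" using Q[of 0] by auto
  obtain k S where N: "N = smult k Q + S" and S: "S = 0 \<or> degree S < degree Q"
    using degree_reduce[OF Q0 deg] .
  have "((\<lambda>z. poly S z / poly Q z) \<longlongrightarrow> 0) at_infinity"
    using S by (auto intro: poly_divide_tendsto_0_at_infinity)
  from tendstoD[OF this, of 1] obtain r where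
    r: "\<And>z. r \<le> norm z \<Longrightarrow> cmod (poly S z / poly Q z) < 1"
    by (auto simp: eventually_at_infinity)
  have "compact ((\<lambda>x::real. poly S (of_real x) / poly Q (of_real x)) ` {- \<bar>r\<bar>..\<bar>r\<bar>})"
    using Q by (intro compact_continuous_image) (auto intro!: continuous_intros)
  then have "bounded ((\<lambda>x::real. poly S (of_real x) / poly Q (of_real x)) ` {- \<bar>r\<bar>..\<bar>r\<bar>})"
    by (rule compact_imp_bounded)
  then obtain C where C: "\<And>x. x \<in> {- \<bar>r\<bar>..\<bar>r\<bar>} \<Longrightarrow> cmod (poly S (of_real x) / poly Q (of_real x)) \<le> C"
    unfolding bounded_iff by blast
  show thesis
  proof
    fix x :: real
    have "cmod (poly S (of_real x) / poly Q (of_real x)) \<le> max 1 C"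
    proof (cases "x \<in> {- \<bar>r\<bar>..\<bar>r\<bar>}")
      case True
      then show ?thesis using C by force
    next
      case False
      then have "r \<le> norm (complex_of_real x)" by auto
      then show ?thesis using r[of "complex_of_real x"] by linarith
    qed
    moreover have "poly N (of_real x) / poly Q (of_real x) = k + poly S (of_real x) / poly Q (of_real x)"
      using Q[of x] by (simp add: N field_simps)
    ultimately show "cmod (poly N (of_real x) / poly Q (of_real x)) \<le> cmod k + max 1 C"
      using norm_triangle_ineq[of k] by (metis add_left_mono order_trans)
  qed
qed

text \<open>
  The degree condition says that the quotient times \<open>1 + x\<^sup>2\<close>, the reciprocal of the
  weight, is bounded.\<close>

lemma rational_le_cauchy_weight:
  fixes N Q :: "complex poly"
  assumes Q: "\<And>x::real. poly Q (of_real x) \<noteq> 0" and deg: "degree (N * [:1, 0, 1:]) \<le> degree (Q * Q)"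
  obtains C where "\<And>x::real. cmod (poly N (of_real x) / (poly Q (of_real x))\<^sup>2) \<le> C * cauchy_weight x"
proof -
  have "poly (Q * Q) (complex_of_real x) \<noteq> 0" for x using Q by simp
  then obtain C where
    C: "\<And>x::real. cmod (poly (N * [:1, 0, 1:]) (of_real x) / poly (Q * Q) (of_real x)) \<le> C"
    using rational_bounded_on_reals[OF _ deg] by blast
  have "cmod (poly N (of_real x) / (poly Q (of_real x))\<^sup>2) \<le> C * cauchy_weight x" for x :: real
  proof -
    have "poly [:1, 0, 1:] (complex_of_real x) = of_real (1 + x\<^sup>2)"
      by (simp add: power2_eq_square)
    then have "poly (N * [:1, 0, 1:]) (of_real x) / poly (Q * Q) (complex_of_real x)
        = poly N (of_real x) / (poly Q (of_real x))\<^sup>2 * of_real (1 + x\<^sup>2)"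
      by (simp add: power2_eq_square algebra_simps)
    then have "cmod (poly N (of_real x) / (poly Q (of_real x))\<^sup>2) * (1 + x\<^sup>2) \<le> C"
      using C[of x] by (simp only: norm_mult norm_of_real) (simp add: abs_of_nonneg)
    then show ?thesis by (simp add: cauchy_weight_def pos_le_divide_eq add_pos_nonneg)
  qed
  then show thesis by (rule that)
qed

lemma proper_rational_L2_fun:
  fixes P Q :: "complex poly"
  assumes deg: "P = 0 \<or> degree P < degree Q" and Q: "\<And>x::real. poly Q (of_real x) \<noteq> 0"
  shows "(\<lambda>x::real. poly P (of_real x) / poly Q (of_real x)) \<in> L2_fun"
proof -
  have "Q \<noteq> 0" using Q[of 0] by auto
  have "degree (P * P * [:1, 0, 1:]) \<le> degree (Q * Q)"
  proof (cases "P = 0")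
    case False
    then have "degree (P * P * [:1, 0, 1:]) = 2 * degree P + 2" by (subst degree_mult_eq) (auto simp: degree_mult_eq)
    then show ?thesis using False deg \<open>Q \<noteq> 0\<close> by (simp add: degree_mult_eq del: mult_pCons_right)
  qed simp
  then obtain C where C: "\<And>x::real. cmod (poly (P * P) (of_real x) / (poly Q (of_real x))\<^sup>2) \<le> C * cauchy_weight x"
    using rational_le_cauchy_weight[OF Q] by blast
  show ?thesis
  proof (rule L2_fun_if_sq_le_weight)
    show "(\<lambda>x::real. poly P (of_real x) / poly Q (of_real x)) \<in> borel_measurable borel"
      using Q by (intro borel_measurable_continuous_onI continuous_intros) auto
    show "(cmod (poly P (of_real x) / poly Q (of_real x)))\<^sup>2 \<le> C * cauchy_weight x" for x :: real
      using C[of x] by (simp add: norm_divide norm_mult power_divide norm_power power2_eq_square)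
  qed
qed

text \<open>
  Dilations bounded away from \<open>0\<close> preserve the weight up to a constant; this makes the
  Lipschitz estimate below uniform in the dilation parameter.\<close>

lemma cauchy_weight_dilate_le:
  assumes r: "r > 0" and s: "s \<ge> r"
  shows "cauchy_weight (s * x) \<le> (1 + 1 / r\<^sup>2) * cauchy_weight x"
proof -
  have "r\<^sup>2 \<le> s\<^sup>2" using r s by (intro power_mono) auto
  then have "r\<^sup>2 * x\<^sup>2 \<le> s\<^sup>2 * x\<^sup>2" by (rule mult_right_mono) simp
  then have "x\<^sup>2 \<le> s\<^sup>2 * x\<^sup>2 / r\<^sup>2" using r by (simp add: pos_le_divide_eq mult.commute)
  moreover have "(1 + 1 / r\<^sup>2) * (1 + (s * x)\<^sup>2) = 1 + 1 / r\<^sup>2 + s\<^sup>2 * x\<^sup>2 + s\<^sup>2 * x\<^sup>2 / r\<^sup>2"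
    by (simp add: algebra_simps power_mult_distrib)
  moreover have "0 \<le> 1 / r\<^sup>2" "0 \<le> s\<^sup>2 * x\<^sup>2" by simp_all
  ultimately have "1 + x\<^sup>2 \<le> (1 + 1 / r\<^sup>2) * (1 + (s * x)\<^sup>2)" by linarith
  then show ?thesis
    by (simp add: cauchy_weight_def pos_le_divide_eq pos_divide_le_eq add_pos_nonneg)
qed

text \<open>
  The derivative of \<open>s * g (s * x)\<close> in \<open>s\<close> is the derivative of \<open>y * g y\<close>
  at \<open>y = s * x\<close>. The rational function \<open>y * g y\<close> is bounded at infinity, so its
  derivative decays quadratically by the Wronskian bound, even if \<open>g\<close> itself decays only like
  \<open>1 / y\<close>: the slowly decaying leading term \<open>k / x\<close> of \<open>s * g (s * x)\<close>
  is independent of \<open>s\<close>.\<close>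

lemma rational_dilation_lipschitz:
  fixes P Q :: "complex poly"
  assumes deg: "P = 0 \<or> degree P < degree Q" and Q: "\<And>x::real. poly Q (of_real x) \<noteq> 0"
    and r: "r > 0"
  defines "g \<equiv> \<lambda>x::real. poly P (of_real x) / poly Q (of_real x)"
  obtains C where "C \<ge> 0"
    "\<And>s t x. r \<le> s \<Longrightarrow> r \<le> t \<Longrightarrow>
       cmod (of_real s * g (s * x) - of_real t * g (t * x)) \<le> C * \<bar>s - t\<bar> * cauchy_weight x"
proof -
  have Q0: "Q \<noteq> 0" using Q[of 0] by auto
  define R where "R = pCons 0 P"
  define W where "W = pderiv R * Q - R * pderiv Q"
  have "degree R \<le> degree Q" using deg by (auto simp: R_def)
  then obtain K where
    K: "\<And>x::real. cmod (poly W (of_real x) / (poly Q (of_real x))\<^sup>2) \<le> K * cauchy_weight x"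
    using rational_le_cauchy_weight[OF Q] degree_wronskian[OF Q0] unfolding W_def by metis
  have K0: "K \<ge> 0"
  proof -
    have "0 \<le> K * cauchy_weight 0" using K[of 0] norm_ge_zero order_trans by blast
    then show ?thesis by (simp add: cauchy_weight_def)
  qed
  define C where "C = K * (1 + 1 / r\<^sup>2)"
  show thesis
  proof (rule that)
    show "C \<ge> 0" using K0 by (simp add: C_def add_nonneg_nonneg)
    fix s t x :: real
    assume s: "r \<le> s" and t: "r \<le> t"
    \<comment> \<open>The parameter is taken complex, so that the mean value inequality
      is available for holomorphic derivatives; it is applied on the real half-line.\<close>
    let ?f = "\<lambda>z. z * (poly P (z * of_real x) / poly Q (z * of_real x))"
    let ?f' = "\<lambda>z. poly W (z * of_real x) / (poly Q (z * of_real x))\<^sup>2"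
    have "norm (?f (of_real s) - ?f (of_real t)) \<le> C * cauchy_weight x * norm (complex_of_real s - of_real t)"
    proof (rule field_differentiable_bound[where f' = ?f' and S = "of_real ` {r..}"])
      show "convex (complex_of_real ` {r..})"
        by (intro convex_linear_image bounded_linear.linear bounded_linear_of_real convex_real_interval)
      show "complex_of_real s \<in> of_real ` {r..}" "complex_of_real t \<in> of_real ` {r..}"
        using s t by auto
      fix z :: complex assume "z \<in> of_real ` {r..}"
      then obtain u where u: "u \<ge> r" and z: "z = of_real u" by auto
      have nz: "poly Q (z * of_real x) \<noteq> 0" using Q[of "u * x"] by (simp add: z)
      show "(?f has_field_derivative ?f' z) (at z within of_real ` {r..})"
        using nz
        by (auto intro!: derivative_eq_intros DERIV_chain2[OF poly_DERIV]
            simp: W_def R_def pderiv_pCons field_simps power2_eq_square)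
      have "cmod (?f' z) \<le> K * cauchy_weight (u * x)"
        using K[of "u * x"] by (simp add: z)
      also have "\<dots> \<le> C * cauchy_weight x"
        using cauchy_weight_dilate_le[OF r u, of x] K0
        unfolding C_def mult.assoc by (rule mult_left_mono)
      finally show "cmod (?f' z) \<le> C * cauchy_weight x" .
    qed
    moreover have "norm (complex_of_real s - of_real t) = \<bar>s - t\<bar>"
      by (simp only: of_real_diff[symmetric] norm_of_real)
    ultimately show "cmod (of_real s * g (s * x) - of_real t * g (t * x)) \<le> C * \<bar>s - t\<bar> * cauchy_weight x"
      by (simp add: g_def mult_ac)
  qed
qed

section \<open>Openness along a hyperbola\<close>

theorem corollary1p3:
  fixes P Q :: "complex poly" and g :: "real \<Rightarrow> complex" and c :: real
  assumes "P = 0 \<or> degree P < degree Q"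
    and "\<And>x::real. poly Q (of_real x) \<noteq> 0"
    and "\<And>x::real. g x = poly P (of_real x) / poly Q (of_real x)"
    and "c > 0"
  shows "open {\<alpha>::real. \<alpha> > 0 \<and> (\<alpha>, c / \<alpha>) \<in> frame_set g}"
proof -
  have g: "g = (\<lambda>x. poly P (of_real x) / poly Q (of_real x))" using assms(3) by auto
  have gL2: "g \<in> L2_fun" unfolding g by (rule proper_rational_L2_fun[OF assms(1,2)])
  define G where "G \<alpha> = (\<lambda>x. of_real \<alpha> * g (\<alpha> * x))" for \<alpha> :: real
  have GL2: "G \<alpha> \<in> L2_fun" if "\<alpha> > 0" for \<alpha>
    unfolding G_def by (intro L2_fun_cmult L2_fun_dilate that gL2)
  have frame_iff: "(\<alpha>, c / \<alpha>) \<in> frame_set g \<longleftrightarrow> gabor_frame (G \<alpha>) 1 c" if "\<alpha> > 0" for \<alpha>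
    using gabor_frame_dilate_iff[OF that, of g \<alpha> "c / \<alpha>"] that \<open>c > 0\<close>
    by (simp add: frame_set_def G_def)
  show ?thesis
    unfolding open_dist
  proof (intro ballI)
    fix \<alpha> assume "\<alpha> \<in> {\<alpha>. \<alpha> > 0 \<and> (\<alpha>, c / \<alpha>) \<in> frame_set g}"
    then have \<alpha>: "\<alpha> > 0" and frame: "gabor_frame (G \<alpha>) 1 c" using frame_iff by auto
    obtain \<epsilon> where \<epsilon>: "\<epsilon> > 0" and stable:
      "\<And>g'. g' \<in> borel_measurable borel \<Longrightarrow> (\<And>x. cmod (g' x - G \<alpha> x) \<le> \<epsilon> * cauchy_weight x)
        \<Longrightarrow> gabor_frame g' 1 c"
      using gabor_frame_stable[OF _ \<open>c > 0\<close> GL2[OF \<alpha>] frame] by auto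
    obtain C where C: "C \<ge> 0" and lip: "\<And>s t x. \<alpha> / 2 \<le> s \<Longrightarrow> \<alpha> / 2 \<le> t \<Longrightarrow>
       cmod (G s x - G t x) \<le> C * \<bar>s - t\<bar> * cauchy_weight x"
      using rational_dilation_lipschitz[OF assms(1,2), of "\<alpha> / 2"] \<alpha>
      unfolding G_def g by auto
    \<comment> \<open>The first bound keeps the parameter above \<open>\<alpha> / 2\<close>, where the Lipschitz estimate holds.\<close>
    define \<delta> where "\<delta> = min (\<alpha> / 2) (\<epsilon> / (C + 1))"
    have "\<delta> > 0" using \<alpha> \<epsilon> C by (simp add: \<delta>_def)
    moreover have "\<beta> > 0 \<and> (\<beta>, c / \<beta>) \<in> frame_set g" if "dist \<beta> \<alpha> < \<delta>" for \<beta>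
    proof -
      have "\<bar>\<beta> - \<alpha>\<bar> < \<alpha> / 2" and near: "\<bar>\<beta> - \<alpha>\<bar> < \<epsilon> / (C + 1)"
        using that by (auto simp: \<delta>_def dist_real_def)
      then have \<beta>: "\<beta> \<ge> \<alpha> / 2" by linarith
      have "C * \<bar>\<beta> - \<alpha>\<bar> \<le> (C + 1) * \<bar>\<beta> - \<alpha>\<bar>" by (rule mult_right_mono) auto
      also have "\<dots> \<le> \<epsilon>" using near C by (simp add: field_simps)
      finally have small: "C * \<bar>\<beta> - \<alpha>\<bar> \<le> \<epsilon>" .
      have "gabor_frame (G \<beta>) 1 c"
      proof (rule stable)
        show "G \<beta> \<in> borel_measurable borel" using \<alpha> \<beta> by (intro L2_fun_measurable GL2) auto
        fix x
        have "cmod (G \<beta> x - G \<alpha> x) \<le> C * \<bar>\<beta> - \<alpha>\<bar> * cauchy_weight x"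
          using \<alpha> \<beta> by (intro lip) auto
        also have "\<dots> \<le> \<epsilon> * cauchy_weight x"
          using small cauchy_weight_pos[of x] by (intro mult_right_mono) auto
        finally show "cmod (G \<beta> x - G \<alpha> x) \<le> \<epsilon> * cauchy_weight x" .
      qed
      then show ?thesis using \<alpha> \<beta> frame_iff[of \<beta>] by auto
    qed
    ultimately show "\<exists>e>0. \<forall>y. dist y \<alpha> < e \<longrightarrow> y \<in> {\<alpha>. \<alpha> > 0 \<and> (\<alpha>, c / \<alpha>) \<in> frame_set g}"
      by auto
  qed
qed

end
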